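(* For every integer $t \geq 1$ there exists a solution to $\mathrm{HWP}(12t;6,4;1,6t-2)$.
   Context: For integers $M,N \geq 3$ and even $v$, a solution to $\mathrm{HWP}(v;M,N;\alpha,\beta)$ is a decomposition of the edge set of $K_v - F$, for some 1-factor (perfect matching) $F$ of $K_v$, into $\alpha$ $C_M$-factors and $\beta$ $C_N$-factors, where a $C_M$-factor is a spanning subgraph all of whose connected components are cycles of length $M$. *)

theory Defs
  imports Main
begin

text \<open>A graph on a vertex set \<open>V\<close> is given by its set of edges, each edge being a two-element
  subset of \<open>V\<close>; spanning subgraphs of the complete graph on \<open>V\<close> are thus exactly the subsets of
  \<open>complete_edges V\<close>.\<close>

definition complete_edges :: "'a set \<Rightarrow> 'a set set" where
  "complete_edges V = {{x, y} | x y. x \<in> V \<and> y \<in> V \<and> x \<noteq> y}"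

definition one_factor :: "'a set \<Rightarrow> 'a set set \<Rightarrow> bool" where
  "one_factor V F \<longleftrightarrow> F \<subseteq> complete_edges V \<and> (\<forall>x\<in>V. \<exists>!e. e \<in> F \<and> x \<in> e)"

definition component_rel :: "'a set \<Rightarrow> 'a set set \<Rightarrow> ('a \<times> 'a) set" where
  "component_rel V E = {(x, y) \<in> V \<times> V. (x, y) \<in> {(a, b). {a, b} \<in> E}\<^sup>*}"

definition components :: "'a set \<Rightarrow> 'a set set \<Rightarrow> 'a set set" where
  "components V E = V // component_rel V E"

definition induced_edges :: "'a set set \<Rightarrow> 'a set \<Rightarrow> 'a set set" where
  "induced_edges E W = {e \<in> E. e \<subseteq> W}"

definition is_cycle :: "nat \<Rightarrow> 'a set \<Rightarrow> 'a set set \<Rightarrow> bool" where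
  "is_cycle k W E \<longleftrightarrow> 3 \<le> k \<and>
     (\<exists>xs. distinct xs \<and> length xs = k \<and> set xs = W \<and>
           E = {{xs ! i, xs ! (Suc i mod k)} | i. i < k})"

definition cycle_factor :: "nat \<Rightarrow> 'a set \<Rightarrow> 'a set set \<Rightarrow> bool" where
  "cycle_factor k V E \<longleftrightarrow> E \<subseteq> complete_edges V \<and>
     (\<forall>W \<in> components V E. is_cycle k W (induced_edges E W))"

definition decomposes :: "'a set set list \<Rightarrow> 'a set set \<Rightarrow> bool" where
  "decomposes Hs E \<longleftrightarrow> \<Union>(set Hs) = E \<and>
     (\<forall>i < length Hs. \<forall>j < length Hs. i \<noteq> j \<longrightarrow> Hs ! i \<inter> Hs ! j = {})"

text \<open>\<open>F\<close> is the removed 1-factor of the complete graph \<open>K\<^sub>v\<close> on \<open>{..<v}\<close>, and \<open>As\<close>, \<open>Bs\<close> list the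
  \<open>C\<^sub>M\<close>-factors and the \<open>C\<^sub>N\<close>-factors.\<close>

definition HWP_solution ::
  "nat \<Rightarrow> nat \<Rightarrow> nat \<Rightarrow> nat \<Rightarrow> nat \<Rightarrow> nat set set \<Rightarrow> nat set set list \<Rightarrow> nat set set list \<Rightarrow> bool"
where
  "HWP_solution v M N \<alpha> \<beta> F As Bs \<longleftrightarrow>
     one_factor {..<v} F \<and>
     length As = \<alpha> \<and> (\<forall>H \<in> set As. cycle_factor M {..<v} H) \<and>
     length Bs = \<beta> \<and> (\<forall>H \<in> set Bs. cycle_factor N {..<v} H) \<and>
     decomposes (As @ Bs) (complete_edges {..<v} - F)"

end

theory Submission
  imports Defs
begin

text \<open>Split the \<open>12 * t\<close> vertices into \<open>2 * t\<close> groups of six and take a 1-factorization of the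
  complete graph on the groups. One of its 1-factors merges the groups into blocks of twelve, and
  each block carries a solution for 12 points: a 1-factor, one \<open>C\<^sub>6\<close>-factor and four
  \<open>C\<^sub>4\<close>-factors. Each of the other \<open>2 * t - 2\<close> 1-factors of the groups blows up to disjoint copies of \<open>K\<^sub>6\<^sub>,\<^sub>6\<close>. Since
  \<open>K\<^sub>6\<^sub>,\<^sub>6\<close> is \<open>K\<^sub>3\<^sub>,\<^sub>3\<close> with every vertex doubled, the three perfect matchings of a 1-factorization of \<open>K\<^sub>3\<^sub>,\<^sub>3\<close> turn
  into three \<open>C\<^sub>4\<close>-factors, so there are \<open>4 + 3 * (2 * t - 2) = 6 * t - 2\<close> of them in total.\<close>

section \<open>Cycles as vertex lists and a criterion for cycle factors\<close>

definition cyc_edges :: "'a list \<Rightarrow> 'a set set" where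
  "cyc_edges xs = {{xs ! i, xs ! (Suc i mod length xs)} | i. i < length xs}"

text \<open>This form is executable, so \<open>code_simp\<close> can evaluate
  \<open>cyc_edges\<close> in the checks of the 12-point solution.\<close>

lemma cyc_edges_image [code]:
  "cyc_edges xs = (\<lambda>i. {xs ! i, xs ! (Suc i mod length xs)}) ` {..<length xs}"
  unfolding cyc_edges_def by auto

lemma cyc_edges_map: "cyc_edges (map f xs) = (`) f ` cyc_edges xs"
  unfolding cyc_edges_image image_image length_map
proof (rule image_cong[OF refl])
  fix i assume "i \<in> {..<length xs}"
  moreover from this have "Suc i mod length xs < length xs"
    by (intro mod_less_divisor) auto
  ultimately show "{map f xs ! i, map f xs ! (Suc i mod length xs)} =
      f ` {xs ! i, xs ! (Suc i mod length xs)}"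
    by simp
qed

lemma cyc_edges_elim:
  assumes "e \<in> cyc_edges xs"
  shows "\<exists>a\<in>set xs. \<exists>b\<in>set xs. e = {a, b}"
proof -
  obtain i where i: "i < length xs" "e = {xs ! i, xs ! (Suc i mod length xs)}"
    using assms unfolding cyc_edges_def by blast
  have "xs ! (Suc i mod length xs) \<in> set xs"
    using i(1) by (intro nth_mem mod_less_divisor) auto
  with i show ?thesis using nth_mem by blast
qed

lemma cyc_edges_doubletonD: "{a, b} \<in> cyc_edges xs \<Longrightarrow> b \<in> set xs"
  by (auto simp: doubleton_eq_iff dest!: cyc_edges_elim)

text \<open>Walking along the list reaches every entry from \<open>xs ! 0\<close>; by symmetry any
  two entries are joined through it.\<close>

lemma rtrancl_cyc_edges:
  assumes "x \<in> set xs" "y \<in> set xs" and sub: "cyc_edges xs \<subseteq> E"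
  shows "(x, y) \<in> {(a, b). {a, b} \<in> E}\<^sup>*"
proof -
  let ?R = "{(a, b). {a, b} \<in> E}"
  have sym: "sym (?R\<^sup>*)"
    by (rule sym_rtrancl) (auto simp: sym_def insert_commute)
  have reach: "(xs ! 0, xs ! i) \<in> ?R\<^sup>*" if "i < length xs" for i
    using that
  proof (induction i)
    case (Suc i)
    have "{xs ! i, xs ! (Suc i mod length xs)} \<in> cyc_edges xs"
      unfolding cyc_edges_def using Suc.prems by (intro CollectI exI[of _ i]) simp
    then have "(xs ! i, xs ! Suc i) \<in> ?R"
      using Suc.prems sub by auto
    with Suc.IH[OF Suc_lessD[OF Suc.prems]] show ?case
      by (rule rtrancl_into_rtrancl)
  qed simp
  obtain i j where ij: "i < length xs" "j < length xs" "x = xs ! i" "y = xs ! j"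
    using assms(1,2) by (metis in_set_conv_nth)
  show ?thesis
    unfolding ij(3,4) by (rule rtrancl_trans[OF symD[OF sym reach[OF ij(1)]] reach[OF ij(2)]])
qed

text \<open>Turns the global condition on components into a local one. Since \<open>b\<close> is
  unrestricted, no edge of \<open>E\<close> leaves \<open>set xs\<close>, while the cycle connects
  it; so \<open>set xs\<close> is the component of \<open>x\<close>.\<close>

lemma cycle_factorI:
  assumes E: "E \<subseteq> complete_edges V" and k: "3 \<le> k"
    and cyc: "\<And>x. x \<in> V \<Longrightarrow> \<exists>xs. distinct xs \<and> length xs = k \<and> x \<in> set xs \<and> set xs \<subseteq> V \<and>
      (\<forall>a \<in> set xs. \<forall>b. {a, b} \<in> E \<longleftrightarrow> {a, b} \<in> cyc_edges xs)"
  shows "cycle_factor k V E"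
  unfolding cycle_factor_def
proof (intro conjI ballI E)
  fix W assume "W \<in> components V E"
  then obtain x where x: "x \<in> V" and W: "W = component_rel V E `` {x}"
    unfolding components_def by (elim quotientE)
  obtain xs where xs: "distinct xs" "length xs = k" "x \<in> set xs" "set xs \<subseteq> V"
    and edge: "\<And>a b. a \<in> set xs \<Longrightarrow> {a, b} \<in> E \<longleftrightarrow> {a, b} \<in> cyc_edges xs"
    using cyc[OF x] by blast
  have sub: "cyc_edges xs \<subseteq> E"
    using edge by (blast dest: cyc_edges_elim)
  have closed: "y \<in> set xs" if "(x, y) \<in> {(a, b). {a, b} \<in> E}\<^sup>*" for y
    using that
  proof induction
    case (step y z)
    then have "{y, z} \<in> cyc_edges xs" using edge by simp
    then show ?case by (rule cyc_edges_doubletonD)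
  qed (rule xs(3))
  have W_eq: "W = set xs"
    unfolding W component_rel_def
    using x xs(4) by (auto intro: closed rtrancl_cyc_edges[OF xs(3) _ sub])
  have "induced_edges E W = cyc_edges xs"
  proof (intro equalityI subsetI)
    fix e assume "e \<in> induced_edges E W"
    then have e: "e \<in> E" "e \<subseteq> set xs"
      by (auto simp: induced_edges_def W_eq)
    then obtain a b where "e = {a, b}"
      using E unfolding complete_edges_def by blast
    then show "e \<in> cyc_edges xs" using e edge by blast
  next
    fix e assume "e \<in> cyc_edges xs"
    then show "e \<in> induced_edges E W"
      using sub by (auto simp: induced_edges_def W_eq dest: cyc_edges_elim)
  qed
  then show "is_cycle k W (induced_edges E W)"
    unfolding is_cycle_def using k xs W_eq by (auto simp: cyc_edges_def intro!: exI[of _ xs])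
qed

section \<open>Edge colourings and their classes\<close>

definition colour_class :: "'a set \<Rightarrow> ('a \<Rightarrow> 'a \<Rightarrow> 'c) \<Rightarrow> 'c \<Rightarrow> 'a set set" where
  "colour_class V col c = {{x, y} | x y. x \<in> V \<and> y \<in> V \<and> x \<noteq> y \<and> col x y = c}"

lemma colour_class_subset: "colour_class V col c \<subseteq> complete_edges V"
  unfolding colour_class_def complete_edges_def by blast

lemma doubleton_in_colour_class:
  assumes "\<And>x y. col x y = col y x"
  shows "{x, y} \<in> colour_class V col c \<longleftrightarrow> x \<in> V \<and> y \<in> V \<and> x \<noteq> y \<and> col x y = c"
  unfolding colour_class_def using assms by (auto simp: doubleton_eq_iff)

section \<open>Round-robin 1-factorization of the groups\<close>

text \<open>The round-robin tournament on \<open>{..n}\<close>, in which \<open>n\<close> plays the role of the point at infinity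
  added to the integers modulo \<open>n\<close>. For \<open>i \<noteq> j\<close> the sum \<open>s\<close> is below \<open>2 * n\<close>, so
  one conditional subtraction reduces it modulo \<open>n\<close>.\<close>

definition round_robin :: "nat \<Rightarrow> nat \<Rightarrow> nat \<Rightarrow> nat" where
  "round_robin n i j =
    (let s = if i = n then 2 * j else if j = n then 2 * i else i + j
     in if s < n then s else s - n)"

lemma round_robin_commute: "round_robin n i j = round_robin n j i"
  by (simp add: round_robin_def Let_def add.commute)

lemma round_robin_less:
  "i \<le> n \<Longrightarrow> j \<le> n \<Longrightarrow> i \<noteq> j \<Longrightarrow> round_robin n i j < n"
  by (auto simp: round_robin_def Let_def)

text \<open>As \<open>n\<close> is odd, \<open>2 * j = n\<close> is impossible, so the opponent of
  \<open>n\<close> is 0; any other two points have a sum strictly between 0 and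
  \<open>2 * n\<close>, which reduces to 0 only at \<open>n\<close>.\<close>

lemma round_robin_eq_0_iff:
  "odd n \<Longrightarrow> i \<le> n \<Longrightarrow> j \<le> n \<Longrightarrow> i \<noteq> j \<Longrightarrow> round_robin n i j = 0 \<longleftrightarrow> i + j = n"
  by (auto simp: round_robin_def Let_def split: if_splits)

lemma round_robin_ex1:
  assumes "odd n" "i \<le> n" "k < n"
  shows "\<exists>!j. j \<le> n \<and> j \<noteq> i \<and> round_robin n i j = k"
proof (cases "i = n")
  case True
  show ?thesis
  proof (rule ex1I)
    \<comment> \<open>Since \<open>n\<close> is odd, exactly one of \<open>k\<close> and
      \<open>k + n\<close> is even; its half solves \<open>2 * j = k\<close> modulo
      \<open>n\<close>.\<close>
    let ?j = "if even k then k div 2 else (k + n) div 2"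
    show "?j \<le> n \<and> ?j \<noteq> i \<and> round_robin n i ?j = k"
      using assms True by (auto simp: round_robin_def Let_def elim!: evenE oddE)
    show "j = ?j" if "j \<le> n \<and> j \<noteq> i \<and> round_robin n i j = k" for j
      using assms True that by (auto simp: round_robin_def Let_def split: if_splits)
  qed
next
  case False
  show ?thesis
  proof (rule ex1I)
    \<comment> \<open>The opponent of \<open>i\<close> is \<open>k - i\<close> modulo
      \<open>n\<close>, except that \<open>i\<close> meets \<open>n\<close> when this would be
      \<open>i\<close> itself.\<close>
    let ?j0 = "if i \<le> k then k - i else k + n - i"
    let ?j = "if ?j0 = i then n else ?j0"
    show "?j \<le> n \<and> ?j \<noteq> i \<and> round_robin n i ?j = k"
      using assms False by (auto simp: round_robin_def Let_def)
    show "j = ?j" if "j \<le> n \<and> j \<noteq> i \<and> round_robin n i j = k" for j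
      using assms False that by (auto simp: round_robin_def Let_def split: if_splits)
  qed
qed

text \<open>Relabelling by \<open>seat\<close> turns the colour-0 matching of the tournament into the
  pairs \<open>{2 * i, 2 * i + 1}\<close>.\<close>

definition seat :: "nat \<Rightarrow> nat \<Rightarrow> nat" where
  "seat t g = (if even g then g div 2 else 2 * t - 1 - g div 2)"

lemma seat_bij: "bij_betw (seat t) {..<2 * t} {..2 * t - 1}" if "t > 0"
  by (rule bij_betw_byWitness[where f' = "\<lambda>j. if j < t then 2 * j else 2 * (2 * t - 1 - j) + 1"])
    (use that in \<open>auto simp: seat_def image_subset_iff elim!: evenE oddE\<close>)

text \<open>The labels \<open>2 * i\<close> and \<open>2 * i + 1\<close> sit at \<open>i\<close> and
  \<open>2 * t - 1 - i\<close>. The seats of two even labels add up to less than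
  \<open>2 * t - 1\<close>, those of two odd labels to more.\<close>

lemma seat_add_eq_iff:
  assumes "g < 2 * t" "h < 2 * t" "g \<noteq> h"
  shows "seat t g + seat t h = 2 * t - 1 \<longleftrightarrow> g div 2 = h div 2"
  using assms by (auto simp: seat_def elim!: evenE oddE)

definition group_colour :: "nat \<Rightarrow> nat \<Rightarrow> nat \<Rightarrow> nat" where
  "group_colour t g h = round_robin (2 * t - 1) (seat t g) (seat t h)"

lemma group_colour_commute: "group_colour t g h = group_colour t h g"
  by (simp add: group_colour_def round_robin_commute)

lemma seat_inj:
  assumes "g < 2 * t" "h < 2 * t"
  shows "seat t g = seat t h \<longleftrightarrow> g = h"
  using seat_bij[of t] assms by (auto simp: bij_betw_def inj_on_def)

lemma seat_le: "g < 2 * t \<Longrightarrow> seat t g \<le> 2 * t - 1"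
  by (auto simp: seat_def)

lemma group_colour_eq_0_iff:
  assumes "g < 2 * t" "h < 2 * t" "g \<noteq> h"
  shows "group_colour t g h = 0 \<longleftrightarrow> g div 2 = h div 2"
proof -
  have "odd (2 * t - 1)" using assms by simp
  then show ?thesis
    unfolding group_colour_def using assms
    by (subst round_robin_eq_0_iff) (simp_all add: seat_le seat_inj seat_add_eq_iff del: One_nat_def)
qed

lemma group_colour_less:
  assumes "g < 2 * t" "h < 2 * t" "g \<noteq> h"
  shows "group_colour t g h < 2 * t - 1"
  unfolding group_colour_def using assms
  by (intro round_robin_less) (simp_all add: seat_le seat_inj del: One_nat_def)

text \<open>The tournament supplies the unique opponent; as colour 0 is exactly the pairing of
  groups into blocks, a positive colour leads to another block.\<close>

lemma group_colour_ex1: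
  assumes g: "g < 2 * t" and k: "0 < k" "k < 2 * t - 1"
  shows "\<exists>!h. h < 2 * t \<and> h div 2 \<noteq> g div 2 \<and> group_colour t g h = k"
proof -
  let ?s = "seat t"
  have "odd (2 * t - 1)" using g by simp
  then obtain j where j: "j \<le> 2 * t - 1" "j \<noteq> ?s g" "round_robin (2 * t - 1) (?s g) j = k"
    and uniq: "\<And>j'. j' \<le> 2 * t - 1 \<Longrightarrow> j' \<noteq> ?s g \<Longrightarrow>
      round_robin (2 * t - 1) (?s g) j' = k \<Longrightarrow> j' = j"
    using round_robin_ex1[OF _ seat_le[OF g] k(2)] by blast
  obtain h where h: "h < 2 * t" "?s h = j"
    using seat_bij[of t] j(1) g unfolding bij_betw_def by force
  show ?thesis
  proof (rule ex1I[of _ h], intro conjI)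
    show hk: "group_colour t g h = k"
      using j(3) h(2) by (simp add: group_colour_def)
    have "g \<noteq> h" using j(2) h(2) by auto
    then show "h div 2 \<noteq> g div 2"
      using group_colour_eq_0_iff[OF g h(1)] hk k(1) by auto
    fix h' assume h': "h' < 2 * t \<and> h' div 2 \<noteq> g div 2 \<and> group_colour t g h' = k"
    then have "?s h' = j"
      using g by (intro uniq) (auto simp: seat_le seat_inj group_colour_def simp del: One_nat_def)
    then show "h' = h" using h h' seat_inj by blast
  qed (rule h(1))
qed

section \<open>Colours between different blocks\<close>

text \<open>The index \<open>X\<close> stands for the two vertices \<open>2 * X\<close> and \<open>2 * X + 1\<close>, so that groups have three
  indices and blocks six. The values are meaningful only for indices in different blocks, where
  the colour of the groups is positive.\<close>

definition pair_colour :: "nat \<Rightarrow> nat \<Rightarrow> nat \<Rightarrow> nat" where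
  "pair_colour t X Y = 3 * (group_colour t (X div 3) (Y div 3) - 1) + (X + Y) mod 3"

lemma pair_colour_commute: "pair_colour t X Y = pair_colour t Y X"
  by (simp add: pair_colour_def group_colour_commute add.commute)

lemma pair_colour_less:
  assumes "X < 6 * t" "Y < 6 * t" "X div 6 \<noteq> Y div 6"
  shows "pair_colour t X Y < 6 * t - 6"
proof -
  have b: "X div 3 < 2 * t" "Y div 3 < 2 * t" "X div 3 div 2 \<noteq> Y div 3 div 2"
    using assms by (auto simp flip: div_mult2_eq)
  then have ne: "X div 3 \<noteq> Y div 3" by metis
  have "0 < group_colour t (X div 3) (Y div 3)" "group_colour t (X div 3) (Y div 3) < 2 * t - 1"
    using group_colour_eq_0_iff[OF b(1,2) ne] group_colour_less[OF b(1,2) ne] b(3) by auto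
  moreover have "(X + Y) mod 3 < 3" by simp
  ultimately show ?thesis unfolding pair_colour_def by linarith
qed

text \<open>Division of \<open>e\<close> by 3: the quotient selects the colour of the groups, hence
  the partner group, and the remainder selects one of its three indices.\<close>

lemma pair_colour_ex1:
  assumes X: "X < 6 * t" and e: "e < 6 * t - 6"
  shows "\<exists>!Y. Y < 6 * t \<and> Y div 6 \<noteq> X div 6 \<and> pair_colour t X Y = e"
proof -
  have g: "X div 3 < 2 * t" using X by auto
  \<comment> \<open>Colour 0 of the groups is used up inside the blocks, so the quotient is shifted
    by one.\<close>
  define k where "k = Suc (e div 3)"
  have k: "0 < k" "k < 2 * t - 1" using e by (auto simp: k_def)
  obtain h where h: "h < 2 * t" "h div 2 \<noteq> X div 3 div 2" "group_colour t (X div 3) h = k"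
    and uniq: "\<And>h'. h' < 2 * t \<Longrightarrow> h' div 2 \<noteq> X div 3 div 2 \<Longrightarrow>
      group_colour t (X div 3) h' = k \<Longrightarrow> h' = h"
    using group_colour_ex1[OF g k] by blast
  \<comment> \<open>Modulo 3, \<open>2 * X\<close> is \<open>- X\<close>, so \<open>X + b\<close> is
    congruent to \<open>e\<close>.\<close>
  define b where "b = (e + 2 * X) mod 3"
  have b: "b < 3" by (simp add: b_def)
  have div6: "Y div 6 = Y div 3 div 2" for Y :: nat by (simp flip: div_mult2_eq)
  show ?thesis
  proof (rule ex1I[of _ "3 * h + b"], intro conjI)
    have d: "(3 * h + b) div 3 = h" using b by simp
    show "3 * h + b < 6 * t" using h(1) b by linarith
    show "(3 * h + b) div 6 \<noteq> X div 6" using h(2) by (simp add: div6 d)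
    have "(X + (3 * h + b)) mod 3 = (X + (e + 2 * X)) mod 3"
      unfolding b_def by (metis add.left_commute mod_add_right_eq mod_mult_self4)
    also have "\<dots> = e mod 3" by simp
    finally have "(X + (3 * h + b)) mod 3 = e mod 3" .
    then show "pair_colour t X (3 * h + b) = e"
      by (simp add: pair_colour_def d h(3) k_def)
  next
    fix Y assume Y: "Y < 6 * t \<and> Y div 6 \<noteq> X div 6 \<and> pair_colour t X Y = e"
    then have Y3: "Y div 3 < 2 * t" "X div 3 \<noteq> Y div 3" "Y div 3 div 2 \<noteq> X div 3 div 2"
      by (auto simp: div6)
    have pos: "0 < group_colour t (X div 3) (Y div 3)"
      using group_colour_eq_0_iff[OF g Y3(1,2)] Y3(3) by auto
    have "e div 3 = group_colour t (X div 3) (Y div 3) - 1" "e mod 3 = (X + Y) mod 3"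
      using Y by (auto simp: pair_colour_def)
    moreover from this(2) have "(e + 2 * X) mod 3 = (X + Y + 2 * X) mod 3"
      by (rule mod_add_cong) simp
    then have "Y mod 3 = b"
      by (simp add: b_def)
    ultimately have "Y div 3 = h" "Y mod 3 = b"
      using pos Y3 by (auto intro!: uniq simp: k_def)
    then show "Y = 3 * h + b" by (metis mult_div_mod_eq)
  qed
qed

section \<open>The solution on 12 points\<close>

text \<open>A solution for 12 points, found by computer search; the removed 1-factor consists of the
  pairs \<open>{u, u + 6}\<close>.\<close>

definition k12_cycles :: "nat list list list" where
  "k12_cycles =
   [[[0, 1, 2, 3, 4, 5], [6, 7, 8, 9, 10, 11]],
    [[0, 2, 5, 3], [1, 4, 6, 9], [7, 10, 8, 11]],
    [[0, 4, 7, 9], [1, 8, 3, 11], [2, 6, 5, 10]],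
    [[0, 7, 3, 10], [1, 5, 8, 6], [2, 4, 9, 11]],
    [[0, 8, 4, 11], [1, 3, 6, 10], [2, 7, 5, 9]]]"

text \<open>Entry \<open>(u, w)\<close> is \<open>Suc c\<close> if \<open>{u, w}\<close> is an edge of one of the cycles in
  \<open>k12_cycles ! c\<close>, and 0 on the removed 1-factor and on the diagonal.\<close>

definition k12_table :: "nat list list" where
  "k12_table =
   [[0, 1, 2, 2, 3, 1, 0, 4, 5, 3, 4, 5],
    [1, 0, 1, 5, 2, 4, 4, 0, 3, 2, 5, 3],
    [2, 1, 0, 1, 4, 2, 3, 5, 0, 5, 3, 4],
    [2, 5, 1, 0, 1, 2, 5, 4, 3, 0, 4, 3],
    [3, 2, 4, 1, 0, 1, 2, 3, 5, 4, 0, 5],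
    [1, 4, 2, 2, 1, 0, 3, 5, 4, 5, 3, 0],
    [0, 4, 3, 5, 2, 3, 0, 1, 4, 2, 5, 1],
    [4, 0, 5, 4, 3, 5, 1, 0, 1, 3, 2, 2],
    [5, 3, 0, 3, 5, 4, 4, 1, 0, 1, 2, 2],
    [3, 2, 5, 0, 4, 5, 2, 3, 1, 0, 1, 4],
    [4, 5, 3, 4, 0, 3, 5, 2, 2, 1, 0, 1],
    [5, 3, 4, 3, 5, 0, 1, 2, 2, 4, 1, 0]]"

definition k12_colour :: "nat \<Rightarrow> nat \<Rightarrow> nat" where
  "k12_colour u w = k12_table ! u ! w"

lemma k12_table_check:
  "\<forall>u\<in>{..<12}. \<forall>w\<in>{..<12}. k12_colour u w = k12_colour w u \<and> k12_colour u w < 6"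
  by code_simp

lemma k12_removed_check:
  "\<forall>u\<in>{..<12}. \<forall>w\<in>{..<12}. w \<noteq> u \<longrightarrow> k12_colour u w = 0 \<longleftrightarrow> w = (u + 6) mod 12"
  by code_simp

text \<open>Here \<open>w\<close> runs over all twelve points, so the check also shows that no edge
  of colour \<open>Suc c\<close> leaves a listed cycle, as \<open>cycle_factorI\<close>
  demands.\<close>

lemma k12_cycles_check:
  "\<forall>c\<in>{..<5}. \<forall>us\<in>set (k12_cycles ! c).
     distinct us \<and> length us = (if c = 0 then 6 else 4) \<and>
     (\<forall>u\<in>set us. u < 12 \<and>
       (\<forall>w\<in>{..<12}. (w \<noteq> u \<and> k12_colour u w = Suc c) = ({u, w} \<in> cyc_edges us)))"
  by code_simp

lemma k12_cycles_cover: "\<forall>c\<in>{..<5}. \<forall>u\<in>{..<12}. \<exists>us\<in>set (k12_cycles ! c). u \<in> set us"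
  by code_simp

section \<open>The colouring of all edges and its factors\<close>

text \<open>Colours below 6 stay inside blocks and the others join different blocks, so the two
  ranges never clash. Colour 0 is the removed 1-factor, colour 1 the factor into 6-cycles, and each
  colour from 2 to \<open>6 * t - 1\<close> a factor into 4-cycles.\<close>

definition colour :: "nat \<Rightarrow> nat \<Rightarrow> nat \<Rightarrow> nat" where
  "colour t x y =
    (if x div 12 = y div 12 then k12_colour (x mod 12) (y mod 12)
     else 6 + pair_colour t (x div 2) (y div 2))"

lemma k12_colour_commute: "u < 12 \<Longrightarrow> w < 12 \<Longrightarrow> k12_colour u w = k12_colour w u"
  using bspec[OF bspec[OF k12_table_check, of u], of w] by simp

lemma k12_colour_less: "u < 12 \<Longrightarrow> w < 12 \<Longrightarrow> k12_colour u w < 6"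
  using bspec[OF bspec[OF k12_table_check, of u], of w] by simp

lemma k12_colour_eq_0_iff:
  "u < 12 \<Longrightarrow> w < 12 \<Longrightarrow> w \<noteq> u \<Longrightarrow> k12_colour u w = 0 \<longleftrightarrow> w = (u + 6) mod 12"
  using bspec[OF bspec[OF k12_removed_check, of u], of w] by simp

lemma colour_commute: "colour t x y = colour t y x"
  by (simp add: colour_def pair_colour_commute k12_colour_commute)

lemmas doubleton_in_colour = doubleton_in_colour_class[of "colour t" for t, OF colour_commute]

lemma colour_less:
  assumes "x < 12 * t" "y < 12 * t"
  shows "colour t x y < 6 * t"
proof (cases "x div 12 = y div 12")
  case True
  then have "colour t x y < 6"
    using k12_colour_less[of "x mod 12" "y mod 12"] by (simp add: colour_def)
  also have "6 \<le> 6 * t" using assms(1) by (cases t) auto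
  finally show ?thesis .
next
  case False
  then have "pair_colour t (x div 2) (y div 2) < 6 * t - 6"
    using assms by (intro pair_colour_less) (auto simp flip: div_mult2_eq)
  then show ?thesis using False by (simp add: colour_def)
qed

text \<open>Between distinct vertices colour 0 occurs only inside blocks, where it joins positions
  six apart modulo 12; this gives the partner of \<open>x\<close> explicitly.\<close>

lemma colour_0_one_factor: "one_factor {..<12 * t} (colour_class {..<12 * t} (colour t) 0)"
  unfolding one_factor_def
proof (intro conjI ballI colour_class_subset)
  fix x assume x: "x \<in> {..<12 * t}"
  let ?E = "colour_class {..<12 * t} (colour t) 0"
  define y where "y = 12 * (x div 12) + (x mod 12 + 6) mod 12"
  have y: "y div 12 = x div 12" "y mod 12 = (x mod 12 + 6) mod 12"
    by (simp_all add: y_def)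
  have y_less: "y < 12 * t"
    using x y(1) by (simp add: mult.commute flip: div_less_iff_less_mult)
  \<comment> \<open>\<open>k12_colour\<close> is also 0 on the diagonal, so reading off the partner
    requires distinct positions.\<close>
  have shift: "(u + 6) mod 12 \<noteq> u" if "u < 12" for u :: nat
    using that by (cases "u < 6") (auto simp: le_mod_geq)
  have y_ne: "y mod 12 \<noteq> x mod 12" unfolding y(2) by (rule shift) simp
  have iff: "{x, z} \<in> ?E \<longleftrightarrow> z = y" for z
  proof
    assume "{x, z} \<in> ?E"
    then have z: "z \<noteq> x" "colour t x z = 0" by (auto simp: doubleton_in_colour)
    then have d: "x div 12 = z div 12" by (auto simp: colour_def split: if_splits)
    then have "z mod 12 \<noteq> x mod 12" using z(1) by (metis mult_div_mod_eq)
    then have "z mod 12 = y mod 12"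
      using z(2) d by (simp add: colour_def k12_colour_eq_0_iff y(2))
    then show "z = y" using d y(1) by (metis mult_div_mod_eq)
  next
    assume "z = y"
    then show "{x, z} \<in> ?E"
      using x y_less y y_ne by (auto simp: doubleton_in_colour colour_def k12_colour_eq_0_iff)
  qed
  show "\<exists>!e. e \<in> ?E \<and> x \<in> e"
  proof (rule ex1I[of _ "{x, y}"])
    fix e assume e: "e \<in> ?E \<and> x \<in> e"
    then obtain a b where "e = {a, b}" "x \<in> {a, b}"
      unfolding colour_class_def by blast
    then obtain z where "e = {x, z}" by blast
    then show "e = {x, y}" using e iff by auto
  qed (simp add: iff)
qed

text \<open>Each block carries a translate of the cycles in \<open>k12_cycles ! c\<close>, so the
  cycle through \<open>x\<close> is the translate of one through \<open>x mod 12\<close>.\<close>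

lemma k12_colour_cycle_factor:
  assumes c: "c < 5"
  shows "cycle_factor (if c = 0 then 6 else 4) {..<12 * t}
    (colour_class {..<12 * t} (colour t) (Suc c))"
proof (rule cycle_factorI[OF colour_class_subset])
  fix x assume x: "x \<in> {..<12 * t}"
  define q where "q = x div 12"
  have q: "12 * q + w < 12 * t" if "w < 12" for w
  proof -
    have "q < t" using x by (simp add: q_def less_mult_imp_div_less mult.commute)
    then show ?thesis using that by linarith
  qed
  let ?f = "\<lambda>w. 12 * q + w"
  have "inj ?f" by (simp add: inj_def)
  then have inj: "inj ((`) ?f)" by (intro injI) (simp only: inj_image_eq_iff)
  obtain us where us: "us \<in> set (k12_cycles ! c)" "x mod 12 \<in> set us"
    using k12_cycles_cover c by force
  have dist: "distinct us" and len: "length us = (if c = 0 then 6 else 4)"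
    and less: "\<And>u. u \<in> set us \<Longrightarrow> u < 12"
    and edge: "\<And>u w. u \<in> set us \<Longrightarrow> w < 12 \<Longrightarrow>
      {u, w} \<in> cyc_edges us \<longleftrightarrow> w \<noteq> u \<and> k12_colour u w = Suc c"
    using bspec[OF bspec[OF k12_cycles_check, of c] us(1)] c by auto
  have "{?f u, b} \<in> colour_class {..<12 * t} (colour t) (Suc c) \<longleftrightarrow>
      {?f u, b} \<in> cyc_edges (map ?f us)" if u: "u \<in> set us" for u b
  proof (cases "b div 12 = q")
    case True
    then obtain w where w: "b = ?f w" "w < 12"
      by (metis mod_less_divisor mult_div_mod_eq zero_less_numeral)
    have "{?f u, b} \<in> cyc_edges (map ?f us) \<longleftrightarrow> ?f ` {u, w} \<in> (`) ?f ` cyc_edges us"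
      by (simp add: cyc_edges_map w(1))
    also have "\<dots> \<longleftrightarrow> {u, w} \<in> cyc_edges us"
      using inj by (rule inj_image_mem_iff)
    finally show ?thesis
      using edge[OF u w(2)] q less[OF u] w by (auto simp: doubleton_in_colour colour_def)
  next
    \<comment> \<open>Edges between blocks have colour at least 6, whereas \<open>Suc c\<close> is
      at most 5; both sides are false.\<close>
    case False
    then have "b \<notin> set (map ?f us)" using less by auto
    then show ?thesis
      using False less[OF u] c
      by (auto simp: doubleton_in_colour colour_def dest: cyc_edges_doubletonD)
  qed
  then have "\<forall>a\<in>set (map ?f us). \<forall>b. {a, b} \<in> colour_class {..<12 * t} (colour t) (Suc c) \<longleftrightarrow>
      {a, b} \<in> cyc_edges (map ?f us)"
    by simp
  moreover have "x \<in> set (map ?f us)"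
    using us(2) by (auto simp: q_def image_iff intro!: bexI[of _ "x mod 12"])
  moreover have "distinct (map ?f us)" using dist by (simp add: distinct_map inj_on_def)
  moreover have "set (map ?f us) \<subseteq> {..<12 * t}" using less q by auto
  ultimately show "\<exists>xs. distinct xs \<and> length xs = (if c = 0 then 6 else 4) \<and> x \<in> set xs \<and>
      set xs \<subseteq> {..<12 * t} \<and> (\<forall>a\<in>set xs. \<forall>b.
      {a, b} \<in> colour_class {..<12 * t} (colour t) (Suc c) \<longleftrightarrow> {a, b} \<in> cyc_edges xs)"
    using len by (intro exI[of _ "map ?f us"]) simp
qed simp

lemma cyc_edges_4: "cyc_edges [p, q, r, s] = {{p, q}, {q, r}, {r, s}, {s, p}}"
  by (simp add: cyc_edges_image lessThan_Suc insert_commute)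

text \<open>In colour \<open>6 + e\<close> each of the two vertices of index \<open>X\<close> is
  adjacent exactly to the two vertices of the unique partner index \<open>Y\<close>, and conversely;
  alternating between them gives a 4-cycle.\<close>

lemma pair_colour_cycle_factor:
  assumes e: "e < 6 * t - 6"
  shows "cycle_factor 4 {..<12 * t} (colour_class {..<12 * t} (colour t) (6 + e))"
proof (rule cycle_factorI[OF colour_class_subset])
  fix x assume x: "x \<in> {..<12 * t}"
  let ?E = "colour_class {..<12 * t} (colour t) (6 + e)"
  define X where "X = x div 2"
  have X: "X < 6 * t" using x by (auto simp: X_def)
  obtain Y where Y: "Y < 6 * t" "Y div 6 \<noteq> X div 6" "pair_colour t X Y = e"
    using pair_colour_ex1[OF X e] by blast
  \<comment> \<open>Kept general in \<open>P\<close> and \<open>Q\<close> to serve for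
    \<open>X\<close>, \<open>Y\<close> in both orders.\<close>
  have edge: "{a, b} \<in> ?E \<longleftrightarrow> b div 2 = Q"
    if PQ: "P < 6 * t" "Q < 6 * t" "Q div 6 \<noteq> P div 6" "pair_colour t P Q = e"
      and a: "a div 2 = P" for a b P Q
  proof -
    have div12: "z div 12 = z div 2 div 6" for z :: nat by (simp flip: div_mult2_eq)
    have "b < 12 * t \<longleftrightarrow> b div 2 < 6 * t" "a < 12 * t" using PQ(1) a by auto
    \<comment> \<open>Colours inside a block are at most 5, so colour \<open>6 + e\<close> forces
      different blocks.\<close>
    moreover have "\<not> k12_colour (a mod 12) (b mod 12) = 6 + e"
      using k12_colour_less[of "a mod 12" "b mod 12"] by simp
    ultimately have "{a, b} \<in> ?E \<longleftrightarrow>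
        b div 2 < 6 * t \<and> b div 2 div 6 \<noteq> P div 6 \<and> pair_colour t P (b div 2) = e"
      using a by (auto simp: doubleton_in_colour colour_def div12)
    then show ?thesis using pair_colour_ex1[OF PQ(1) e] PQ by blast
  qed
  have half: "b div 2 = Z \<longleftrightarrow> b = 2 * Z \<or> b = 2 * Z + 1" for b Z :: nat by auto
  let ?xs = "[2 * X, 2 * Y, 2 * X + 1, 2 * Y + 1]"
  have XY: "X \<noteq> Y" using Y(2) by auto
  have "{a, b} \<in> ?E \<longleftrightarrow> {a, b} \<in> cyc_edges ?xs" if "a \<in> set ?xs" for a b
  proof (cases "a div 2 = X")
    case True
    then have "a = 2 * X \<or> a = 2 * X + 1" by (simp add: half)
    then have "{a, b} \<in> cyc_edges ?xs \<longleftrightarrow> b = 2 * Y \<or> b = 2 * Y + 1"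
      using XY by (auto simp: cyc_edges_4 doubleton_eq_iff)
    then show ?thesis using edge[OF X Y True] by (simp add: half)
  next
    case False
    with that have a: "a div 2 = Y" by auto
    then have "a = 2 * Y \<or> a = 2 * Y + 1" by (simp add: half)
    then have "{a, b} \<in> cyc_edges ?xs \<longleftrightarrow> b = 2 * X \<or> b = 2 * X + 1"
      using XY by (auto simp: cyc_edges_4 doubleton_eq_iff)
    then show ?thesis
      using edge[OF Y(1) X Y(2)[symmetric] _ a] Y(3) by (simp add: half pair_colour_commute)
  qed
  moreover have "x \<in> set ?xs" using X_def by auto
  moreover have "distinct ?xs" using XY by auto
  moreover have "set ?xs \<subseteq> {..<12 * t}" using X Y(1) by auto
  moreover have "length ?xs = 4" by simp
  ultimately show "\<exists>xs. distinct xs \<and> length xs = 4 \<and> x \<in> set xs \<and> set xs \<subseteq> {..<12 * t} \<and>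
      (\<forall>a\<in>set xs. \<forall>b. {a, b} \<in> ?E \<longleftrightarrow> {a, b} \<in> cyc_edges xs)"
    by (intro exI[of _ ?xs] conjI ballI allI)
qed simp

text \<open>Symmetry gives every edge a single colour, so distinct classes are disjoint; once class
  0 is removed, the bound leaves only the colours 1 to \<open>m - 1\<close>.\<close>

lemma decomposes_colour_classes:
  assumes sym: "\<And>x y. col x y = col y x"
    and less: "\<And>x y. x \<in> V \<Longrightarrow> y \<in> V \<Longrightarrow> x \<noteq> y \<Longrightarrow> col x y < m"
  shows "decomposes (map (colour_class V col) [1..<m]) (complete_edges V - colour_class V col 0)"
proof -
  have disj: "colour_class V col c \<inter> colour_class V col d = {}" if "c \<noteq> d" for c d
  proof -
    have False if e: "e \<in> colour_class V col c" "e \<in> colour_class V col d" for e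
    proof -
      obtain x y where "e = {x, y}" using e(1) unfolding colour_class_def by blast
      then show False
        using e \<open>c \<noteq> d\<close> by (simp add: doubleton_in_colour_class[of col, OF sym])
    qed
    then show ?thesis by blast
  qed
  have "\<Union> (set (map (colour_class V col) [1..<m])) = complete_edges V - colour_class V col 0"
  proof (intro equalityI subsetI)
    fix e assume "e \<in> \<Union> (set (map (colour_class V col) [1..<m]))"
    then obtain c where "1 \<le> c" "e \<in> colour_class V col c" by auto
    then show "e \<in> complete_edges V - colour_class V col 0"
      using disj[of c 0] colour_class_subset[of V col c] by auto
  next
    fix e assume e: "e \<in> complete_edges V - colour_class V col 0"
    then obtain x y where xy: "e = {x, y}" "x \<in> V" "y \<in> V" "x \<noteq> y"
      unfolding complete_edges_def by blast
    then have "e \<in> colour_class V col (col x y)"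
      by (simp add: doubleton_in_colour_class[of col, OF sym])
    moreover from this e have "col x y \<noteq> 0" by (metis DiffD2)
    ultimately show "e \<in> \<Union> (set (map (colour_class V col) [1..<m]))"
      using less[OF xy(2-4)] by auto
  qed
  then show ?thesis unfolding decomposes_def by (auto simp: disj)
qed

theorem theorem6:
  fixes t :: nat
  assumes "t \<ge> 1"
  shows "\<exists>F As Bs. HWP_solution (12 * t) 6 4 1 (6 * t - 2) F As Bs"
proof -
  let ?H = "colour_class {..<12 * t} (colour t)"
  have six: "cycle_factor 6 {..<12 * t} (?H 1)"
    using k12_colour_cycle_factor[of 0 t] by simp
  \<comment> \<open>Colours 2 to 5 come from inside the blocks, the rest from pairs of blocks:
    \<open>6 * t - 2\<close> in all.\<close>
  have four: "cycle_factor 4 {..<12 * t} (?H c)" if c: "2 \<le> c" "c < 6 * t" for c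
  proof (cases "c < 6")
    case True
    then show ?thesis using k12_colour_cycle_factor[of "c - 1" t] c by simp
  next
    case False
    then show ?thesis using pair_colour_cycle_factor[of "c - 6" t] c by simp
  qed
  have "[1..<6 * t] = 1 # [2..<6 * t]"
    using assms by (simp add: upt_conv_Cons numeral_2_eq_2)
  then have "decomposes ([?H 1] @ map ?H [2..<6 * t]) (complete_edges {..<12 * t} - ?H 0)"
    using decomposes_colour_classes[of "colour t" "{..<12 * t}" "6 * t"] colour_commute colour_less
    by simp
  then have "HWP_solution (12 * t) 6 4 1 (6 * t - 2) (?H 0) [?H 1] (map ?H [2..<6 * t])"
    unfolding HWP_solution_def using colour_0_one_factor six four by simp
  then show ?thesis by blast
qed

end
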